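(* Let $\delta>0$, let $(X,d,\mu)$ be an Ahlfors $\delta$-regular metric-measure space and let $\Delta$ be its logarithmic Dirichlet Laplacian on $L^2(X,\mu)$. Let $\operatorname{Din}(X,d)$ be the set of Dini continuous functions on $(X,d)$, which is contained in $\operatorname{Dom}\Delta$. For every $f\in\operatorname{Din}(X,d)$ and $x\in X$ we have the principal value integral representation $$\Delta f(x)=\int_X\frac{f(x)-f(y)}{d(x,y)^\delta}\,d\mu(y)$$ (that is, the function of $x$ on the right-hand side represents the element $\Delta f$ of $L^2(X,\mu)$), and $\Delta f\in L^\infty(X,\mu)\subset L^2(X,\mu)$.
   Context: A metric-measure space is a triple $(X,d,\mu)$ where $(X,d)$ is a locally compact second-countable metric space and $\mu$ is a finite Borel measure on $X$. It is Ahlfors $\delta$-regular ($\delta>0$) if there is $C\ge 1$ such that $C^{-1}r^\delta\le\mu(\overline B(x,r))\le Cr^\delta$ for all $x\in X$ and $0\le r<\operatorname{diam}X$; then $\operatorname{diam} X<\infty$. $L^2(X,\mu)$ denotes the real Hilbert space of real-valued square-integrable functions. Define $$\operatorname{Dom}\mathcal E=\Big\{f\in L^2(X,\mu):\int_X\int_X\frac{|f(x)-f(y)|^2}{d(x,y)^\delta}\,d\mu(y)\,d\mu(x)<\infty\Big\},$$ $$\mathcal E(f,g)=\frac12\int_X\int_X\frac{(f(x)-f(y))(g(x)-g(y))}{d(x,y)^\delta}\,d\mu(y)\,d\mu(x),\qquad f,g\in\operatorname{Dom}\mathcal E,$$ the integrals being over the complement of the diagonal in $X\times X$. This is a densely defined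 closed form. The logarithmic Dirichlet Laplacian $\Delta$ is the positive self-adjoint operator associated with $\mathcal E$: if $R:L^2(X,\mu)\to\operatorname{Dom}\mathcal E$ is determined by $\langle Rf,g\rangle_{L^2}+\mathcal E(Rf,g)=\langle f,g\rangle_{L^2}$ for all $g\in\operatorname{Dom}\mathcal E$, then $\operatorname{Dom}\Delta=R(L^2(X,\mu))$ and $\Delta Rf=f-Rf$. Thus $R=(1+\Delta)^{-1}$, $\operatorname{Dom}\mathcal E=\operatorname{Dom}\Delta^{1/2}$ and $\mathcal E(f,g)=\langle\Delta^{1/2}f,\Delta^{1/2}g\rangle_{L^2}$. A bounded uniformly continuous function $f:X\to\mathbb R$ is Dini continuous if $\int_0^1\frac{\omega_f(t)}{t}\,dt<\infty$, where $\omega_f(t)=\sup\{|f(x)-f(y)|:d(x,y)\le t\operatorname{diam}(X)\}$ for $t\in[0,1]$. The principal value integral at $x$ is $\lim_{\varepsilon\to0}\int_{\{y:\,d(x,y)\geq\varepsilon\}}$. *)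

theory Defs
  imports "HOL-Analysis.Analysis"
begin

text \<open>
  The space \<open>X\<close> is the universe of a type \<open>'a\<close>; since the type is arbitrary, so is the
  (nonempty) metric space.
\<close>

definition metric_measure_space ::
  "'a::{metric_space, second_countable_topology} measure \<Rightarrow> bool" where
  "metric_measure_space M \<longleftrightarrow>
     locally compact (UNIV :: 'a set) \<and> sets M = sets borel \<and> finite_measure M"

text \<open>
  The diameter is extended-real-valued, because the library's \<^const>\<open>diameter\<close> is \<open>0\<close> on
  unbounded sets, which would make the regularity condition below void for unbounded \<open>X\<close>.
\<close>

definition ediam :: "'a::metric_space itself \<Rightarrow> ereal" where
  "ediam _ = (SUP (x::'a, y::'a)\<in>UNIV. ereal (dist x y))"

definition ahlfors_regular ::
  "real \<Rightarrow> 'a::{metric_space, second_countable_topology} measure \<Rightarrow> bool" where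
  "ahlfors_regular \<delta> M \<longleftrightarrow>
     (\<exists>C\<ge>1. \<forall>(x::'a) r. 0 \<le> r \<and> ereal r < ediam TYPE('a) \<longrightarrow>
        inverse C * r powr \<delta> \<le> measure M (cball x r) \<and>
        measure M (cball x r) \<le> C * r powr \<delta>)"

text \<open>
  Elements of the Hilbert space \<open>L\<^sup>2(X,\<mu>)\<close> are handled through their representatives,
  equality in \<open>L\<^sup>2\<close> being equality almost everywhere.
\<close>

definition L2 :: "'a measure \<Rightarrow> ('a \<Rightarrow> real) set" where
  "L2 M = {f \<in> borel_measurable M. integrable M (\<lambda>x. (f x)\<^sup>2)}"

definition L2_inner :: "'a measure \<Rightarrow> ('a \<Rightarrow> real) \<Rightarrow> ('a \<Rightarrow> real) \<Rightarrow> real" where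
  "L2_inner M f g = (LINT x|M. f x * g x)"

definition Linf :: "'a measure \<Rightarrow> ('a \<Rightarrow> real) set" where
  "Linf M = {f \<in> borel_measurable M. \<exists>B. AE x in M. \<bar>f x\<bar> \<le> B}"

definition Dom_form :: "real \<Rightarrow> 'a::metric_space measure \<Rightarrow> ('a \<Rightarrow> real) set" where
  "Dom_form \<delta> M =
     {f \<in> L2 M. (\<integral>\<^sup>+x. (\<integral>\<^sup>+y\<in>-{x}. ennreal (\<bar>f x - f y\<bar>\<^sup>2 / dist x y powr \<delta>) \<partial>M) \<partial>M) < \<infinity>}"

definition log_form ::
  "real \<Rightarrow> 'a::metric_space measure \<Rightarrow> ('a \<Rightarrow> real) \<Rightarrow> ('a \<Rightarrow> real) \<Rightarrow> real" where
  "log_form \<delta> M f g =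
     1/2 * (LINT x|M. (LINT y:-{x}|M. (f x - f y) * (g x - g y) / dist x y powr \<delta>))"

text \<open>
  \<open>represents_resolvent \<delta> M f u\<close> says that \<open>u\<close> is a representative of the class \<open>R f\<close>, where
  \<open>R = (1 + \<Delta>)\<^sup>-\<^sup>1\<close>. It is a relation since \<open>R f\<close> is only determined almost everywhere.
\<close>

definition represents_resolvent ::
  "real \<Rightarrow> 'a::metric_space measure \<Rightarrow> ('a \<Rightarrow> real) \<Rightarrow> ('a \<Rightarrow> real) \<Rightarrow> bool" where
  "represents_resolvent \<delta> M f u \<longleftrightarrow>
     u \<in> Dom_form \<delta> M \<and>
     (\<forall>g\<in>Dom_form \<delta> M. L2_inner M u g + log_form \<delta> M u g = L2_inner M f g)"

definition Dom_log_laplacian :: "real \<Rightarrow> 'a::metric_space measure \<Rightarrow> ('a \<Rightarrow> real) set" where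
  "Dom_log_laplacian \<delta> M = {u. \<exists>f\<in>L2 M. represents_resolvent \<delta> M f u}"

text \<open>
  \<open>\<Delta> (R f) = f - R f\<close>. The value is some representative of the class \<open>\<Delta> u\<close>, so it is meaningful
  up to equality almost everywhere, and only for \<open>u\<close> in the domain.
\<close>

definition log_laplacian ::
  "real \<Rightarrow> 'a::metric_space measure \<Rightarrow> ('a \<Rightarrow> real) \<Rightarrow> ('a \<Rightarrow> real)" where
  "log_laplacian \<delta> M u =
     (SOME v. v \<in> L2 M \<and>
        (\<exists>f\<in>L2 M. represents_resolvent \<delta> M f u \<and> (AE x in M. v x = f x - u x)))"

definition modulus_of_continuity :: "('a::metric_space \<Rightarrow> real) \<Rightarrow> real \<Rightarrow> real" where
  "modulus_of_continuity f t =
     Sup {\<bar>f x - f y\<bar> | x y. ereal (dist x y) \<le> ereal t * ediam TYPE('a)}"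

definition Din :: "('a::metric_space \<Rightarrow> real) set" where
  "Din = {f. bounded (range f) \<and> uniformly_continuous_on UNIV f \<and>
             set_integrable lborel {0<..1} (\<lambda>t. modulus_of_continuity f t / t)}"

definition has_pv_integral ::
  "'a::metric_space measure \<Rightarrow> 'a \<Rightarrow> ('a \<Rightarrow> real) \<Rightarrow> real \<Rightarrow> bool" where
  "has_pv_integral M x h I \<longleftrightarrow>
     (\<forall>\<epsilon>>0. set_integrable M {y. dist x y \<ge> \<epsilon>} h) \<and>
     ((\<lambda>\<epsilon>. LINT y:{y. dist x y \<ge> \<epsilon>}|M. h y) \<longlongrightarrow> I) (at_right 0)"

end

theory Submission imports Defs begin

text \<open>
  Write \<open>k(x,y) = (f x - f y) / d(x,y)\<^sup>\<delta>\<close> for a Dini continuous \<open>f\<close>. Everything follows from one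
  estimate (\<open>kernel_integral_bounded\<close>): \<open>\<integral> \<bar>k(x,y)\<bar> d\<mu>(y)\<close> is bounded uniformly in \<open>x\<close>. At scale
  \<open>d(x,y) \<approx> t diam X\<close> the numerator is at most \<open>\<omega>\<^sub>f(t)\<close>, while the ball of that radius has measure
  \<open>O(t\<^sup>\<delta>)\<close>, which cancels the denominator; summing over scales against the scale-invariant measure
  \<open>dt/t\<close> leaves the Dini integral \<open>\<integral> \<omega>\<^sub>f(t)/t dt\<close>.

  The principal value is thus an absolutely convergent integral, and the function \<open>h\<close> it defines is
  bounded. Since \<open>\<bar>f x - f y\<bar>\<^sup>2 \<le> 2 (sup \<bar>f\<bar>) \<bar>f x - f y\<bar>\<close>, the function \<open>f\<close> has finite energy. For
  \<open>g\<close> in \<open>L\<^sup>2\<close> the double integral defining \<open>\<E>(f,g)\<close> may be split into the parts with \<open>g x\<close> and with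
  \<open>g y\<close>; as \<open>k\<close> is antisymmetric, both contribute equally and \<open>\<E>(f,g) = \<langle>h,g\<rangle>\<close> (\<open>log_form_Din\<close>).
  Therefore \<open>f = R(f + h)\<close>.

  It remains to see that \<open>\<Delta> f\<close> is well defined, that is, that \<open>R F = f\<close> determines \<open>F\<close> almost
  everywhere (\<open>represents_resolvent_inj\<close>). This is the density of the form domain in \<open>L\<^sup>2\<close>: bounded
  Lipschitz functions are Dini continuous, hence of finite energy, and they separate elements
  of \<open>L\<^sup>2\<close> because they approximate the indicators of closed sets.
\<close>

section \<open>The diameter and the modulus of continuity\<close>

lemma dist_le_ediam: "ereal (dist x y) \<le> ediam TYPE('a)" for x y :: "'a::metric_space"
  unfolding ediam_def by (rule SUP_upper2[of "(x, y)"]) auto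

text \<open>
  In an unbounded space the lower regularity bound would hold at all radii and so exceed the
  total mass.
\<close>

lemma ediam_finite:
  fixes M :: "'a::{metric_space, second_countable_topology} measure"
  assumes "\<delta> > 0" "finite_measure M" "ahlfors_regular \<delta> M"
  obtains D where "D \<ge> 0" "ediam TYPE('a) = ereal D"
proof -
  interpret finite_measure M by fact
  obtain C where C: "C \<ge> 1"
    and lower: "\<And>(x::'a) r. 0 \<le> r \<Longrightarrow> ereal r < ediam TYPE('a)
      \<Longrightarrow> inverse C * r powr \<delta> \<le> measure M (cball x r)"
    using assms(3) unfolding ahlfors_regular_def by blast
  have nonneg: "0 \<le> ediam TYPE('a)"
    using dist_le_ediam[of "undefined :: 'a" undefined] by (simp add: zero_ereal_def)
  have "ediam TYPE('a) \<noteq> \<infinity>"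
  proof
    assume inf: "ediam TYPE('a) = \<infinity>"
    define m where "m = measure M (space M)"
    have m: "m \<ge> 0" by (simp add: m_def)
    \<comment> \<open>Chosen so that the lower bound \<open>r\<^sup>\<delta> / C\<close> equals \<open>m + 1\<close>.\<close>
    define r where "r = (C * (m + 1)) powr (1 / \<delta>)"
    have "inverse C * r powr \<delta> \<le> measure M (cball undefined r)"
      by (rule lower) (auto simp: inf r_def)
    also have "\<dots> \<le> m"
      unfolding m_def by (rule bounded_measure)
    also have "inverse C * r powr \<delta> = m + 1"
      using C m \<open>\<delta> > 0\<close> by (simp add: r_def powr_powr field_simps)
    finally show False by simp
  qed
  with nonneg show ?thesis
    by (cases "ediam TYPE('a)") (auto intro: that simp: zero_ereal_def)
qed

lemma bdd_above_oscillations: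
  fixes f :: "'a::metric_space \<Rightarrow> real"
  assumes "bounded (range f)"
  shows "bdd_above {\<bar>f x - f y\<bar> | x y. P x y}"
proof -
  obtain B where B: "\<And>z. \<bar>f z\<bar> \<le> B"
    using assms unfolding bounded_iff by auto
  have "\<bar>f x - f y\<bar> \<le> 2 * B" for x y
    using B[of x] B[of y] by linarith
  then show ?thesis
    by (auto intro!: bdd_aboveI[of _ "2 * B"])
qed

lemma abs_diff_le_modulus:
  fixes f :: "'a::metric_space \<Rightarrow> real"
  assumes "bounded (range f)" "ediam TYPE('a) = ereal D" "dist x y \<le> t * D"
  shows "\<bar>f x - f y\<bar> \<le> modulus_of_continuity f t"
  unfolding modulus_of_continuity_def
  using assms by (intro cSup_upper bdd_above_oscillations) auto

lemma modulus_nonneg: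
  fixes f :: "'a::metric_space \<Rightarrow> real"
  assumes "bounded (range f)" "ediam TYPE('a) = ereal D" "D \<ge> 0" "t \<ge> 0"
  shows "0 \<le> modulus_of_continuity f t"
  using abs_diff_le_modulus[OF assms(1,2), of undefined undefined t] assms(3,4) by simp

lemma modulus_mono_on:
  fixes f :: "'a::metric_space \<Rightarrow> real"
  assumes "bounded (range f)" "ediam TYPE('a) = ereal D" "D \<ge> 0"
  shows "mono_on {0..} (modulus_of_continuity f)"
proof (rule mono_onI)
  fix s t :: real assume st: "s \<in> {0..}" "s \<le> t"
  have "\<bar>f undefined - f undefined\<bar> \<in> {\<bar>f x - f y\<bar> |x y. dist x y \<le> s * D}"
    using st(1) assms(3) by (intro CollectI exI[of _ undefined]) simp
  moreover have "dist x y \<le> t * D" if "dist x y \<le> s * D" for x y :: 'a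
    using mult_right_mono[OF st(2) assms(3)] that by linarith
  ultimately show "modulus_of_continuity f s \<le> modulus_of_continuity f t"
    unfolding modulus_of_continuity_def assms(2)
    by (intro cSup_subset_mono bdd_above_oscillations assms(1)) auto
qed

lemma modulus_measurable:
  fixes f :: "'a::metric_space \<Rightarrow> real"
  assumes "bounded (range f)" "ediam TYPE('a) = ereal D" "D \<ge> 0"
  shows "(\<lambda>t. indicator {0<..1} t * modulus_of_continuity f t) \<in> borel_measurable borel"
proof -
  have "mono_on {0<..1} (modulus_of_continuity f)"
    using modulus_mono_on[OF assms] by (rule mono_on_subset) auto
  from borel_measurable_mono_on_fnc[OF this] show ?thesis
    by (subst (asm) borel_measurable_restrict_space_iff) auto
qed

lemma lipschitz_in_Din:
  fixes g :: "'a::metric_space \<Rightarrow> real"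
  assumes D: "ediam TYPE('a) = ereal D" "D \<ge> 0"
    and bnd: "bounded (range g)" and lip: "L-lipschitz_on UNIV g"
  shows "g \<in> Din"
proof -
  have L: "L \<ge> 0" and gL: "\<bar>g x - g y\<bar> \<le> L * dist x y" for x y
    using lip by (auto simp: lipschitz_on_def dist_real_def)
  have mod_le: "modulus_of_continuity g t \<le> L * (t * D)" if "t \<ge> 0" for t
    unfolding modulus_of_continuity_def
  proof (rule cSup_least)
    show "{\<bar>g x - g y\<bar> |x y. ereal (dist x y) \<le> ereal t * ediam TYPE('a)} \<noteq> {}"
      using that D by (auto intro!: exI[of _ undefined])
    fix s assume "s \<in> {\<bar>g x - g y\<bar> |x y. ereal (dist x y) \<le> ereal t * ediam TYPE('a)}"
    then obtain x y where "s = \<bar>g x - g y\<bar>" "dist x y \<le> t * D"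
      using D by auto
    then show "s \<le> L * (t * D)"
      using gL[of x y] mult_left_mono[OF \<open>dist x y \<le> t * D\<close> L] by linarith
  qed
  have "set_integrable lborel {0<..1} (\<lambda>t. modulus_of_continuity g t / t)"
    unfolding set_integrable_def
  proof (rule Bochner_Integration.integrable_bound)
    show "integrable lborel (\<lambda>t::real. indicator {0<..1} t * (L * D))"
      by (intro integrable_mult_left integrable_real_indicator) auto
    have "(\<lambda>t. (indicator {0<..1} t * modulus_of_continuity g t) / t) \<in> borel_measurable lborel"
      using modulus_measurable[OF bnd D] by measurable
    then show "(\<lambda>t. indicator {0<..1} t *\<^sub>R (modulus_of_continuity g t / t)) \<in> borel_measurable lborel"
      by simp
    show "AE t in lborel. norm (indicator {0<..1} t *\<^sub>R (modulus_of_continuity g t / t))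
        \<le> norm (indicator {0<..1} t * (L * D))"
    proof (rule AE_I2)
      fix t :: real
      show "norm (indicator {0<..1} t *\<^sub>R (modulus_of_continuity g t / t))
        \<le> norm (indicator {0<..1} t * (L * D))"
      proof (cases "t \<in> {0<..1}")
        case True
        then show ?thesis
          using mod_le[of t] modulus_nonneg[OF bnd D, of t] L D
          by (simp add: field_simps)
      qed simp
    qed
  qed
  then show ?thesis
    using bnd lipschitz_on_uniformly_continuous[OF lip] by (simp add: Din_def)
qed

section \<open>Finite Borel measures on metric spaces\<close>

locale finite_borel_measure = finite_measure M
  for M :: "'a::{metric_space, second_countable_topology} measure" +
  assumes sets_eq_borel: "sets M = sets borel"
begin

lemma space_eq_UNIV [simp]: "space M = UNIV"
  using sets_eq_imp_space_eq[OF sets_eq_borel] by simp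

lemma measurable_of_borel: "g \<in> borel_measurable borel \<Longrightarrow> g \<in> borel_measurable M"
  unfolding measurable_cong_sets[OF sets_eq_borel refl] .

lemma pair_measurable_of_borel:
  "g \<in> borel_measurable (borel \<Otimes>\<^sub>M borel) \<Longrightarrow> g \<in> borel_measurable (M \<Otimes>\<^sub>M M)"
  unfolding measurable_cong_sets[OF sets_pair_measure_cong[OF sets_eq_borel sets_eq_borel] refl] .

text \<open>
  The test functions \<open>max 0 (1 - n d(x,F))\<close> decrease to the indicator of a closed set \<open>F\<close>, so \<open>k\<close>
  has integral zero over closed sets. These form an intersection-stable generator of the
  Borel sets.
\<close>

lemma AE_zero_if_orthogonal_to_lipschitz:
  fixes k :: "'a \<Rightarrow> real"
  assumes k: "integrable M k"
    and orth: "\<And>g L. bounded (range g) \<Longrightarrow> L-lipschitz_on UNIV g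
      \<Longrightarrow> (LINT x|M. k x * g x) = 0"
  shows "AE x in M. k x = 0"
proof (rule density_zero[OF k])
  have closed_zero: "(LINT x:F|M. k x) = 0" if F: "closed F" for F
  proof (cases "F = {}")
    case False
    define g where "g n x = max 0 (1 - real n * infdist x F)" for n x
    have g01: "0 \<le> g n x" "g n x \<le> 1" for n x
      by (auto simp: g_def infdist_nonneg)
    have lip: "(real n)-lipschitz_on UNIV (g n)" for n
    proof (rule lipschitz_onI)
      fix x y :: 'a
      have "\<bar>g n x - g n y\<bar> \<le> \<bar>real n * infdist x F - real n * infdist y F\<bar>"
        unfolding g_def by linarith
      also have "\<dots> = real n * \<bar>infdist x F - infdist y F\<bar>"
        by (simp add: abs_mult flip: right_diff_distrib)
      also have "\<dots> \<le> real n * dist x y"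
        by (intro mult_left_mono infdist_triangle_abs) auto
      finally show "dist (g n x) (g n y) \<le> real n * dist x y"
        by (simp add: dist_real_def)
    qed simp
    have [measurable]: "g n \<in> borel_measurable M" for n
      by (intro measurable_of_borel borel_measurable_continuous_onI lipschitz_on_continuous_on[OF lip])
    have [measurable]: "F \<in> sets M" using F sets_eq_borel by simp
    have "(\<lambda>n. LINT x|M. k x * g n x) \<longlonglongrightarrow> (LINT x|M. k x * indicator F x)"
    proof (rule integral_dominated_convergence[where w = "\<lambda>x. \<bar>k x\<bar>"])
      show "AE x in M. (\<lambda>n. k x * g n x) \<longlonglongrightarrow> k x * indicator F x"
      proof (rule AE_I2)
        fix x
        have "(\<lambda>n. g n x) \<longlonglongrightarrow> indicator F x"
        proof (cases "x \<in> F")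
          case True
          then show ?thesis by (simp add: g_def)
        next
          case False
          then have pos: "infdist x F > 0"
            using F \<open>F \<noteq> {}\<close> by (simp add: infdist_pos_not_in_closed)
          obtain N where N: "1 < real N * infdist x F"
            using reals_Archimedean3[OF pos] by blast
          have "g n x = 0" if "n \<ge> N" for n
            using N mult_right_mono[of "real N" "real n" "infdist x F"] that pos
            unfolding g_def by linarith
          then show ?thesis
            using False by (intro tendsto_eventually) (auto simp: eventually_sequentially)
        qed
        then show "(\<lambda>n. k x * g n x) \<longlonglongrightarrow> k x * indicator F x"
          by (intro tendsto_intros)
      qed
      show "AE x in M. norm (k x * g n x) \<le> \<bar>k x\<bar>" for n
        using g01[of n] by (auto simp: abs_mult intro!: mult_left_le)
    qed (use k in auto)
    moreover have "(LINT x|M. k x * g n x) = 0" for n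
      by (rule orth[OF _ lip]) (use g01[of n] in \<open>auto simp: bounded_iff intro!: exI[of _ 1]\<close>)
    ultimately show ?thesis
      by (simp add: set_lebesgue_integral_def LIMSEQ_const_iff mult.commute)
  qed (simp add: set_lebesgue_integral_def)
  fix A assume "A \<in> sets M"
  then have "Int_stable (Collect (closed :: 'a set \<Rightarrow> bool))" "Collect closed \<subseteq> Pow (UNIV :: 'a set)"
    "A \<in> sigma_sets UNIV (Collect closed)"
    by (auto simp: Int_stable_def sets_eq_borel borel_eq_closed)
  then show "(LINT x:A|M. k x) = 0"
  proof (induction rule: sigma_sets_induct_disjoint)
    case (basic A)
    then show ?case using closed_zero by simp
  next
    case empty
    show ?case by (simp add: set_lebesgue_integral_def)
  next
    case (compl A)
    have A: "A \<in> sets M" using compl(1) by (simp add: sets_eq_borel borel_eq_closed)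
    have si: "set_integrable M B k" if "B \<in> sets M" for B
      unfolding set_integrable_def by (rule integrable_mult_indicator[OF that k])
    have "(LINT x:UNIV|M. k x) = (LINT x:A|M. k x) + (LINT x:UNIV - A|M. k x)"
      using set_integral_Un[of A "UNIV - A" M k] si[OF A] si[of "UNIV - A"] A sets_eq_borel by simp
    then show ?case using closed_zero[OF closed_UNIV] compl(2) by simp
  next
    case (union A)
    have A: "A i \<in> sets M" for i
      using union(2) by (auto simp: sets_eq_borel borel_eq_closed)
    have "(LINT x:(\<Union>i. A i)|M. k x) = (\<Sum>i. LINT x:A i|M. k x)"
    proof (rule lebesgue_integral_countable_add)
      show "set_integrable M (\<Union>i. A i) k"
        unfolding set_integrable_def using A by (intro integrable_mult_indicator k) auto
    qed (use A union(1) in \<open>auto simp: disjoint_family_on_def\<close>)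
    then show ?case using union(3) by simp
  qed
qed

lemma L2_integrable: "g \<in> L2 M \<Longrightarrow> integrable M g"
  by (auto simp: L2_def intro: square_integrable_imp_integrable)

lemma L2_integrable_mult:
  assumes "f \<in> L2 M" "g \<in> L2 M"
  shows "integrable M (\<lambda>x. f x * g x)"
proof (rule Bochner_Integration.integrable_bound)
  show "integrable M (\<lambda>x. (f x)\<^sup>2 + (g x)\<^sup>2)"
    using assms by (auto simp: L2_def)
  show "(\<lambda>x. f x * g x) \<in> borel_measurable M"
    using assms by (auto simp: L2_def)
  have "\<bar>a * b\<bar> \<le> a\<^sup>2 + b\<^sup>2" for a b :: real
  proof -
    have "0 \<le> (\<bar>a\<bar> - \<bar>b\<bar>)\<^sup>2" by simp
    then have "2 * \<bar>a * b\<bar> \<le> a\<^sup>2 + b\<^sup>2" by (simp add: power2_diff abs_mult)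
    then show ?thesis using abs_ge_zero[of "a * b"] by linarith
  qed
  then show "AE x in M. norm (f x * g x) \<le> norm ((f x)\<^sup>2 + (g x)\<^sup>2)"
    by simp
qed

lemma L2_add: "f \<in> L2 M \<Longrightarrow> g \<in> L2 M \<Longrightarrow> (\<lambda>x. f x + g x) \<in> L2 M"
  using L2_integrable_mult[of f g] by (auto simp: L2_def power2_sum mult.assoc)

lemma Linf_subset_L2: "Linf M \<subseteq> L2 M"
proof
  fix f assume "f \<in> Linf M"
  then obtain B where [measurable]: "f \<in> borel_measurable M" and B: "AE x in M. \<bar>f x\<bar> \<le> B"
    by (auto simp: Linf_def)
  have "integrable M (\<lambda>x. (f x)\<^sup>2)"
  proof (rule integrable_const_bound[of _ "B\<^sup>2"])
    show "AE x in M. norm ((f x)\<^sup>2) \<le> B\<^sup>2"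
      using B by eventually_elim (simp add: abs_le_square_iff[symmetric])
  qed simp
  then show "f \<in> L2 M" by (simp add: L2_def)
qed

lemma kernel_measurable:
  assumes [measurable]: "f \<in> borel_measurable borel"
  shows "(\<lambda>(x, y). (f x - f y) / dist x y powr \<delta>) \<in> borel_measurable (M \<Otimes>\<^sub>M M)"
  by (rule pair_measurable_of_borel) measurable

text \<open>
  Removing the diagonal changes nothing: the numerator vanishes there, and division by zero
  gives zero.
\<close>

lemma log_form_eq:
  "log_form \<delta> M f g = 1/2 * (LINT x|M. LINT y|M. (f x - f y) * (g x - g y) / dist x y powr \<delta>)"
proof -
  have "(LINT y:-{x}|M. (f x - f y) * (g x - g y) / dist x y powr \<delta>)
      = (LINT y|M. (f x - f y) * (g x - g y) / dist x y powr \<delta>)" for x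
    unfolding set_lebesgue_integral_def
    by (rule Bochner_Integration.integral_cong) (auto simp: indicator_def)
  then show ?thesis unfolding log_form_def by simp
qed

end

section \<open>The singular integral of a Dini continuous function\<close>

definition singular_integral ::
  "real \<Rightarrow> 'a::metric_space measure \<Rightarrow> ('a \<Rightarrow> real) \<Rightarrow> 'a \<Rightarrow> real" where
  "singular_integral \<delta> M f x = (LINT y|M. (f x - f y) / dist x y powr \<delta>)"

lemma Din_measurable: "f \<in> Din \<Longrightarrow> f \<in> borel_measurable borel"
  by (auto simp: Din_def intro!: borel_measurable_continuous_onI uniformly_continuous_imp_continuous)

locale upper_regular_space = finite_borel_measure M
  for M :: "'a::{metric_space, second_countable_topology} measure" +
  fixes \<delta> D C :: real
  assumes exponent_pos: "\<delta> > 0"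
    and diameter: "ediam TYPE('a) = ereal D" "D \<ge> 0"
    and measure_cball_le: "\<And>x r. 0 \<le> r \<Longrightarrow> r < D \<Longrightarrow> measure M (cball x r) \<le> C * r powr \<delta>"
begin

lemma dist_le_diameter: "dist x y \<le> D" for x y :: 'a
  using dist_le_ediam[of x y] diameter by simp

text \<open>
  For \<open>0 < s < 1/2\<close> with \<open>s D = d(x,y)\<close>, monotonicity of \<open>\<omega> = \<omega>\<^sub>f\<close> gives
  \<open>\<omega>(s) s\<^sup>-\<^sup>\<delta> \<le> 2\<^sup>\<delta>\<^sup>+\<^sup>1 \<integral> \<omega>(t) t\<^sup>-\<^sup>\<delta>\<^sup>-\<^sup>1 dt\<close> over \<open>s \<le> t \<le> 2 s\<close>. Integrating over \<open>y\<close> and exchanging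
  the integrals replaces the sum over dyadic annuli: for fixed \<open>t\<close> the admissible \<open>y\<close> lie in the
  ball of radius \<open>t D\<close>, of measure at most \<open>C (t D)\<^sup>\<delta>\<close>, and \<open>C D\<^sup>\<delta> \<integral> \<omega>(t)/t dt\<close> remains.
\<close>

lemma kernel_integral_bounded:
  fixes f :: "'a \<Rightarrow> real"
  assumes f: "f \<in> Din"
  obtains K where "K \<ge> 0"
    "\<And>x. (\<integral>\<^sup>+y. ennreal (\<bar>f x - f y\<bar> / dist x y powr \<delta>) \<partial>M) \<le> ennreal K"
proof (cases "D = 0")
  case True
  then have "x = y" for x y :: 'a
    using dist_le_diameter[of x y] by simp
  then have zero: "\<bar>f x - f y\<bar> / dist x y powr \<delta> = 0" for x y
    by (metis abs_zero diff_self div_0)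
  show ?thesis
    by (rule that[of 0]) (simp_all only: zero, simp_all)
next
  case False
  then have D: "D > 0" using diameter by simp
  define \<omega> where "\<omega> = modulus_of_continuity f"
  have bnd: "bounded (range f)" using f by (simp add: Din_def)
  then obtain B where B: "\<And>z. \<bar>f z\<bar> \<le> B"
    unfolding bounded_iff by auto
  have B0: "B \<ge> 0" using B[of undefined] by linarith
  have \<omega>: "\<bar>f x - f y\<bar> \<le> \<omega> t" if "dist x y \<le> t * D" for x y t
    unfolding \<omega>_def using abs_diff_le_modulus[OF bnd diameter(1) that] .
  have \<omega>0: "0 \<le> \<omega> t" if "t \<ge> 0" for t
    unfolding \<omega>_def using modulus_nonneg[OF bnd diameter that] .
  have C0: "C * r powr \<delta> \<ge> 0" if "0 \<le> r" "r < D" for r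
    using measure_cball_le[OF that, of undefined] measure_nonneg[of M "cball undefined r"] by linarith
  define w where "w t = indicator {0<..<1} t * (\<omega> t * t powr (- \<delta> - 1))" for t
  have w0: "w t \<ge> 0" for t
    using \<omega>0[of t] by (auto simp: w_def indicator_def)
  have [measurable]: "w \<in> borel_measurable borel"
  proof -
    have [measurable]: "(\<lambda>t. indicator {0<..1} t * \<omega> t) \<in> borel_measurable borel"
      unfolding \<omega>_def by (rule modulus_measurable[OF bnd diameter])
    have "w = (\<lambda>t. indicator {0<..<1} t * ((indicator {0<..1} t * \<omega> t) * t powr (- \<delta> - 1)))"
      by (auto simp: w_def indicator_def)
    also have "\<dots> \<in> borel_measurable borel" by measurable
    finally show ?thesis .
  qed
  define I where "I = (LINT t:{0<..1}|lborel. \<omega> t / t)"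
  have Din_int: "set_integrable lborel {0<..1} (\<lambda>t. \<omega> t / t)"
    using f by (simp add: Din_def \<omega>_def)
  have I: "(\<integral>\<^sup>+t. ennreal (indicator {0<..1} t * (\<omega> t / t)) \<partial>lborel) = ennreal I"
    using nn_integral_eq_integral[OF Din_int[unfolded set_integrable_def]] \<omega>0
    by (auto simp: I_def set_lebesgue_integral_def indicator_def)
  have I0: "I \<ge> 0"
    unfolding I_def set_lebesgue_integral_def using \<omega>0
    by (intro Bochner_Integration.integral_nonneg) (auto simp: indicator_def)
  \<comment> \<open>\<open>A\<close> bounds \<open>\<bar>k(x,y)\<bar>\<close> when \<open>d(x,y) \<ge> D/2\<close>, where \<open>2 s\<close> may leave the range of the Dini integral.\<close>
  define A where "A = 2 * B * (2 / D) powr \<delta>"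
  define c where "c = 2 powr (\<delta> + 1) * D powr - \<delta>"
  have A0: "A \<ge> 0" and c0: "c \<ge> 0" using B0 by (simp_all add: A_def c_def)
  \<comment> \<open>With \<open>s = d(x,y)/D\<close>, this is the scale window \<open>[s, 2 s]\<close>.\<close>
  define S where "S x y = {t. dist x y \<le> t * D \<and> t * D \<le> 2 * dist x y}" for x y :: 'a
  have pointwise: "ennreal (\<bar>f x - f y\<bar> / dist x y powr \<delta>)
      \<le> ennreal A + ennreal c * (\<integral>\<^sup>+t. ennreal (w t) * indicator (S x y) t \<partial>lborel)" for x y
  proof -
    define d where "d = dist x y"
    consider "d = 0" | "d \<ge> D / 2" | "0 < d" "d < D / 2"
      unfolding d_def using zero_le_dist[of x y] by linarith
    then show ?thesis
    proof cases
      case 1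
      then show ?thesis by (simp add: d_def)
    next
      case 2
      have "\<bar>f x - f y\<bar> / d powr \<delta> \<le> 2 * B / (D / 2) powr \<delta>"
        using B[of x] B[of y] 2 D B0 exponent_pos by (intro frac_le powr_mono2) auto
      also have "\<dots> = A"
        using D by (simp add: A_def powr_divide)
      finally have "ennreal (\<bar>f x - f y\<bar> / d powr \<delta>) \<le> ennreal A"
        by (rule ennreal_leI)
      then show ?thesis
        unfolding d_def by (rule order_trans) simp
    next
      case 3
      define s where "s = d / D"
      have s: "0 < s" "2 * s < 1" "d = s * D"
        using 3 D by (auto simp: s_def field_simps)
      have "\<bar>f x - f y\<bar> / d powr \<delta> = c * (\<bar>f x - f y\<bar> * (2 * s) powr (- \<delta> - 1) * s)"
        using s D by (simp add: c_def powr_mult powr_diff powr_add powr_minus field_simps)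
      moreover have "ennreal (\<bar>f x - f y\<bar> * (2 * s) powr (- \<delta> - 1) * s)
          \<le> (\<integral>\<^sup>+t. ennreal (w t) * indicator (S x y) t \<partial>lborel)"
      proof -
        have "ennreal (\<bar>f x - f y\<bar> * (2 * s) powr (- \<delta> - 1) * s)
            = (\<integral>\<^sup>+t. ennreal (\<bar>f x - f y\<bar> * (2 * s) powr (- \<delta> - 1)) * indicator {s..2 * s} t \<partial>lborel)"
          using s by (simp add: nn_integral_cmult_indicator ennreal_mult'')
        also have "\<dots> \<le> (\<integral>\<^sup>+t. ennreal (w t) * indicator (S x y) t \<partial>lborel)"
        proof (rule nn_integral_mono)
          fix t
          show "ennreal (\<bar>f x - f y\<bar> * (2 * s) powr (- \<delta> - 1)) * indicator {s..2 * s} t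
            \<le> ennreal (w t) * indicator (S x y) t"
          proof (cases "t \<in> {s..2 * s}")
            case True
            then have t: "0 < t" "t < 1" "s \<le> t" "t \<le> 2 * s" using s by auto
            have d_le: "d \<le> t * D" "t * D \<le> 2 * d"
              using t D s(3) by auto
            have "\<bar>f x - f y\<bar> * (2 * s) powr (- \<delta> - 1) \<le> \<omega> t * t powr (- \<delta> - 1)"
              using \<omega>[of x y t] d_le t exponent_pos
              by (intro mult_mono powr_mono2') (auto simp: d_def)
            also have "\<dots> = w t" using t by (simp add: w_def)
            finally show ?thesis
              using True d_le by (auto simp: S_def d_def intro: ennreal_leI)
          qed simp
        qed
        finally show ?thesis .
      qed
      ultimately have "ennreal (\<bar>f x - f y\<bar> / dist x y powr \<delta>)
          \<le> ennreal c * (\<integral>\<^sup>+t. ennreal (w t) * indicator (S x y) t \<partial>lborel)"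
        using c0 by (simp add: d_def ennreal_mult' mult_left_mono)
      also have "\<dots> \<le> ennreal A + \<dots>" by simp
      finally show ?thesis .
    qed
  qed
  define m where "m = measure M UNIV"
  have inner: "ennreal (w t) * emeasure M {y. t \<in> S x y}
      \<le> ennreal (C * D powr \<delta>) * ennreal (indicator {0<..1} t * (\<omega> t / t))" for x t
  proof (cases "t \<in> {0<..<1}")
    case True
    then have t: "0 < t" "t < 1" by auto
    then have r: "0 \<le> t * D" "t * D < D" using D by auto
    have "emeasure M {y. t \<in> S x y} \<le> emeasure M (cball x (t * D))"
      by (rule emeasure_mono) (auto simp: S_def sets_eq_borel)
    also have "\<dots> \<le> ennreal (C * (t * D) powr \<delta>)"
      unfolding emeasure_eq_measure by (rule ennreal_leI[OF measure_cball_le[OF r]])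
    finally have "ennreal (w t) * emeasure M {y. t \<in> S x y} \<le> ennreal (w t * (C * (t * D) powr \<delta>))"
      using w0[of t] C0[OF r] by (simp add: ennreal_mult' mult_left_mono)
    also have "w t * (C * (t * D) powr \<delta>) = (C * D powr \<delta>) * (indicator {0<..1} t * (\<omega> t / t))"
      using t D by (simp add: w_def powr_mult powr_diff powr_minus field_simps)
    finally show ?thesis
      using \<omega>0[of t] t by (subst ennreal_mult''[symmetric]) auto
  qed (simp add: w_def)
  have measS: "{p. fst p \<in> S x (snd p)} \<in> sets (borel \<Otimes>\<^sub>M borel)" for x
  proof -
    have "{p \<in> space (borel \<Otimes>\<^sub>M borel). dist x (snd p) \<le> fst p * D \<and> fst p * D \<le> 2 * dist x (snd p)}
        \<in> sets (borel \<Otimes>\<^sub>M borel)"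
      by measurable
    then show ?thesis by (simp add: S_def space_pair_measure)
  qed
  have "(\<integral>\<^sup>+y. ennreal (\<bar>f x - f y\<bar> / dist x y powr \<delta>) \<partial>M)
      \<le> ennreal (A * m + c * (C * D powr \<delta> * I))" for x
  proof -
    interpret pair_sigma_finite lborel M ..
    have jm: "(\<lambda>(t, y). ennreal (w t) * indicator (S x y) t) \<in> borel_measurable (lborel \<Otimes>\<^sub>M M)"
    proof -
      have "(\<lambda>(t, y). ennreal (w t) * indicator {p. fst p \<in> S x (snd p)} (t, y))
          \<in> borel_measurable (borel \<Otimes>\<^sub>M borel)"
        using measS by measurable
      then show ?thesis
        unfolding measurable_cong_sets[OF sets_pair_measure_cong[OF sets_lborel sets_eq_borel] refl]
        by (simp add: indicator_def)
    qed
    have im: "(\<lambda>y. \<integral>\<^sup>+t. ennreal (w t) * indicator (S x y) t \<partial>lborel) \<in> borel_measurable M"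
      using lborel.borel_measurable_nn_integral_fst[of "\<lambda>(y, t). ennreal (w t) * indicator (S x y) t" M]
        measurable_pair_swap[OF jm] by (simp add: case_prod_beta)
    have Sy: "{y. t \<in> S x y} \<in> sets M" for t
      unfolding sets_eq_borel using measurable_sets[OF measurable_Pair1'[of t borel borel] measS[of x]]
      by (simp add: vimage_def)
    have "(\<integral>\<^sup>+y. ennreal (\<bar>f x - f y\<bar> / dist x y powr \<delta>) \<partial>M)
        \<le> (\<integral>\<^sup>+y. ennreal A + ennreal c * (\<integral>\<^sup>+t. ennreal (w t) * indicator (S x y) t \<partial>lborel) \<partial>M)"
      by (intro nn_integral_mono pointwise)
    also have "\<dots> = ennreal A * emeasure M UNIV
        + ennreal c * (\<integral>\<^sup>+y. \<integral>\<^sup>+t. ennreal (w t) * indicator (S x y) t \<partial>lborel \<partial>M)"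
      using im by (simp add: nn_integral_add nn_integral_cmult)
    also have "(\<integral>\<^sup>+y. \<integral>\<^sup>+t. ennreal (w t) * indicator (S x y) t \<partial>lborel \<partial>M)
        = (\<integral>\<^sup>+t. \<integral>\<^sup>+y. ennreal (w t) * indicator (S x y) t \<partial>M \<partial>lborel)"
      by (rule Fubini'[OF jm])
    also have "\<dots> = (\<integral>\<^sup>+t. ennreal (w t) * emeasure M {y. t \<in> S x y} \<partial>lborel)"
    proof (rule nn_integral_cong)
      fix t
      have "(\<integral>\<^sup>+y. ennreal (w t) * indicator (S x y) t \<partial>M)
          = (\<integral>\<^sup>+y. ennreal (w t) * indicator {y. t \<in> S x y} y \<partial>M)"
        by (intro nn_integral_cong) (auto simp: indicator_def)
      then show "(\<integral>\<^sup>+y. ennreal (w t) * indicator (S x y) t \<partial>M) = ennreal (w t) * emeasure M {y. t \<in> S x y}"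
        using nn_integral_cmult_indicator[OF Sy] by simp
    qed
    also have "\<dots> \<le> (\<integral>\<^sup>+t. ennreal (C * D powr \<delta>) * ennreal (indicator {0<..1} t * (\<omega> t / t)) \<partial>lborel)"
      by (intro nn_integral_mono inner)
    also have "\<dots> = ennreal (C * D powr \<delta>) * ennreal I"
      unfolding I[symmetric] using borel_measurable_integrable[OF Din_int[unfolded set_integrable_def]]
      by (intro nn_integral_cmult) simp
    finally have "(\<integral>\<^sup>+y. ennreal (\<bar>f x - f y\<bar> / dist x y powr \<delta>) \<partial>M)
        \<le> ennreal A * emeasure M UNIV + ennreal c * (ennreal (C * D powr \<delta>) * ennreal I)"
      by (simp add: add_left_mono mult_left_mono)
    also have "\<dots> = ennreal (A * m + c * (C * D powr \<delta> * I))"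
    proof -
      have "C * D powr \<delta> \<ge> 0"
        using C0[of "D/2"] D by (auto simp: zero_le_mult_iff)
      then show ?thesis
        using A0 c0 I0 by (simp add: emeasure_eq_measure m_def ennreal_mult ennreal_plus)
    qed
    finally show ?thesis .
  qed
  note bound = order_trans[OF this ennreal_leI[OF max.cobounded2[of _ 0]]]
  show ?thesis
    by (rule that[OF max.cobounded1 bound])
qed

lemma kernel_integrable:
  fixes f :: "'a \<Rightarrow> real"
  assumes f: "f \<in> Din"
  shows "integrable M (\<lambda>y. (f x - f y) / dist x y powr \<delta>)"
proof -
  obtain K where "(\<integral>\<^sup>+y. ennreal (\<bar>f x - f y\<bar> / dist x y powr \<delta>) \<partial>M) \<le> ennreal K"
    using kernel_integral_bounded[OF f] by metis
  moreover have "(\<lambda>y. (f x - f y) / dist x y powr \<delta>) \<in> borel_measurable M"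
    using measurable_Pair2[OF kernel_measurable[OF Din_measurable[OF f]], of x] by simp
  ultimately show ?thesis
    by (intro integrableI_bounded) (auto intro: le_less_trans)
qed

lemma singular_integral_measurable:
  fixes f :: "'a \<Rightarrow> real"
  assumes "f \<in> Din"
  shows "singular_integral \<delta> M f \<in> borel_measurable M"
  using borel_measurable_lebesgue_integral[OF kernel_measurable[OF Din_measurable[OF assms]]]
  unfolding singular_integral_def .

lemma singular_integral_Linf:
  fixes f :: "'a \<Rightarrow> real"
  assumes f: "f \<in> Din"
  shows "singular_integral \<delta> M f \<in> Linf M"
proof -
  obtain K where K: "K \<ge> 0"
    "\<And>x. (\<integral>\<^sup>+y. ennreal (\<bar>f x - f y\<bar> / dist x y powr \<delta>) \<partial>M) \<le> ennreal K"
    using kernel_integral_bounded[OF f] by metis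
  have "\<bar>singular_integral \<delta> M f x\<bar> \<le> K" for x
  proof -
    have "ennreal \<bar>singular_integral \<delta> M f x\<bar> \<le> (\<integral>\<^sup>+y. ennreal (\<bar>f x - f y\<bar> / dist x y powr \<delta>) \<partial>M)"
      using integral_norm_bound_ennreal[OF kernel_integrable[OF f, of x]]
      by (simp add: singular_integral_def)
    also have "\<dots> \<le> ennreal K" by (rule K(2))
    finally show ?thesis using K(1) by simp
  qed
  then show ?thesis
    using singular_integral_measurable[OF f] by (auto simp: Linf_def)
qed

lemma singular_integral_L2: "f \<in> Din \<Longrightarrow> singular_integral \<delta> M f \<in> L2 M"
  using singular_integral_Linf Linf_subset_L2 by blast

lemma Din_bounded_by:
  fixes f :: "'a \<Rightarrow> real"
  assumes "f \<in> Din"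
  obtains B where "B \<ge> 0" "\<And>x. \<bar>f x\<bar> \<le> B"
proof -
  obtain B where "\<And>x. \<bar>f x\<bar> \<le> B"
    using assms unfolding Din_def bounded_iff by auto
  then show ?thesis
    by (intro that[of B]) (auto intro: order_trans[OF abs_ge_zero])
qed

text \<open>
  Boundedness of \<open>f\<close> trades one factor \<open>\<bar>f x - f y\<bar>\<close> for a constant, which reduces the energy to
  the kernel bound.
\<close>

lemma Din_subset_Dom_form: "Din \<subseteq> Dom_form \<delta> M"
proof
  fix f :: "'a \<Rightarrow> real" assume f: "f \<in> Din"
  obtain B where B: "B \<ge> 0" "\<And>x. \<bar>f x\<bar> \<le> B"
    using Din_bounded_by[OF f] by metis
  obtain K where K: "K \<ge> 0"
    "\<And>x. (\<integral>\<^sup>+y. ennreal (\<bar>f x - f y\<bar> / dist x y powr \<delta>) \<partial>M) \<le> ennreal K"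
    using kernel_integral_bounded[OF f] by metis
  have "f \<in> Linf M"
    using B measurable_of_borel[OF Din_measurable[OF f]] by (auto simp: Linf_def)
  then have "f \<in> L2 M"
    using Linf_subset_L2 by blast
  moreover have "(\<integral>\<^sup>+x. (\<integral>\<^sup>+y\<in>-{x}. ennreal (\<bar>f x - f y\<bar>\<^sup>2 / dist x y powr \<delta>) \<partial>M) \<partial>M) < \<infinity>"
  proof -
    have "(\<integral>\<^sup>+y\<in>-{x}. ennreal (\<bar>f x - f y\<bar>\<^sup>2 / dist x y powr \<delta>) \<partial>M) \<le> ennreal (2 * B * K)" for x
    proof -
      have "ennreal (\<bar>f x - f y\<bar>\<^sup>2 / dist x y powr \<delta>) * indicator (-{x}) y
          \<le> ennreal (2 * B) * ennreal (\<bar>f x - f y\<bar> / dist x y powr \<delta>)" for y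
      proof -
        have "\<bar>f x - f y\<bar> * (\<bar>f x - f y\<bar> / dist x y powr \<delta>)
            \<le> 2 * B * (\<bar>f x - f y\<bar> / dist x y powr \<delta>)"
          using B(2)[of x] B(2)[of y] by (intro mult_right_mono) auto
        then have "ennreal (\<bar>f x - f y\<bar>\<^sup>2 / dist x y powr \<delta>)
            \<le> ennreal (2 * B) * ennreal (\<bar>f x - f y\<bar> / dist x y powr \<delta>)"
          using B(1) by (subst ennreal_mult[symmetric])
            (auto intro!: ennreal_leI simp: power2_eq_square simp del: abs_mult_self_eq)
        then show ?thesis by (auto simp: indicator_def)
      qed
      then have "(\<integral>\<^sup>+y\<in>-{x}. ennreal (\<bar>f x - f y\<bar>\<^sup>2 / dist x y powr \<delta>) \<partial>M)
          \<le> (\<integral>\<^sup>+y. ennreal (2 * B) * ennreal (\<bar>f x - f y\<bar> / dist x y powr \<delta>) \<partial>M)"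
        by (intro nn_integral_mono)
      also have "\<dots> = ennreal (2 * B) * (\<integral>\<^sup>+y. ennreal (\<bar>f x - f y\<bar> / dist x y powr \<delta>) \<partial>M)"
      proof (intro nn_integral_cmult measurable_of_borel)
        note [measurable] = Din_measurable[OF f]
        show "(\<lambda>y. ennreal (\<bar>f x - f y\<bar> / dist x y powr \<delta>)) \<in> borel_measurable borel"
          by measurable
      qed
      also have "\<dots> \<le> ennreal (2 * B) * ennreal K"
        by (intro mult_left_mono K) simp
      also have "\<dots> = ennreal (2 * B * K)"
        using B K by (simp add: ennreal_mult)
      finally show ?thesis .
    qed
    then have "(\<integral>\<^sup>+x. (\<integral>\<^sup>+y\<in>-{x}. ennreal (\<bar>f x - f y\<bar>\<^sup>2 / dist x y powr \<delta>) \<partial>M) \<partial>M)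
        \<le> (\<integral>\<^sup>+x. ennreal (2 * B * K) \<partial>M)"
      by (intro nn_integral_mono)
    also have "\<dots> < \<infinity>"
      by (simp add: emeasure_eq_measure ennreal_mult_less_top)
    finally show ?thesis .
  qed
  ultimately show "f \<in> Dom_form \<delta> M"
    by (simp add: Dom_form_def)
qed

text \<open>
  The kernel is absolutely integrable, so the truncated integrals converge by dominated
  convergence. The truncation level is \<open>1/t\<close> with \<open>t\<close> tending to infinity.
\<close>

lemma has_pv_singular_integral:
  fixes f :: "'a \<Rightarrow> real"
  assumes f: "f \<in> Din"
  shows "has_pv_integral M x (\<lambda>y. (f x - f y) / dist x y powr \<delta>) (singular_integral \<delta> M f x)"
proof -
  let ?k = "\<lambda>y. (f x - f y) / dist x y powr \<delta>"
  have sets: "{y. dist x y \<ge> e} \<in> sets M" for e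
    unfolding sets_eq_borel by (intro borel_closed closed_Collect_le continuous_intros)
  have "((\<lambda>t. LINT y:{y. dist x y \<ge> inverse t}|M. ?k y) \<longlongrightarrow> (LINT y|M. ?k y)) at_top"
    unfolding set_lebesgue_integral_def
  proof (rule integral_dominated_convergence_at_top[where w = "\<lambda>y. \<bar>?k y\<bar>"])
    show "\<forall>\<^sub>F t in at_top. AE y in M. norm (indicator {y. inverse t \<le> dist x y} y *\<^sub>R ?k y) \<le> \<bar>?k y\<bar>"
      by (intro always_eventually allI AE_I2) (simp add: indicator_def)
    show "AE y in M. ((\<lambda>t. indicator {y. inverse t \<le> dist x y} y *\<^sub>R ?k y) \<longlongrightarrow> ?k y) at_top"
    proof (rule AE_I2)
      fix y
      show "((\<lambda>t. indicator {y. inverse t \<le> dist x y} y *\<^sub>R ?k y) \<longlongrightarrow> ?k y) at_top"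
      proof (cases "x = y")
        case False
        have "\<forall>\<^sub>F t in at_top. indicator {y. inverse t \<le> dist x y} y *\<^sub>R ?k y = ?k y"
          using eventually_ge_at_top[of "inverse (dist x y)"] eventually_gt_at_top[of 0]
        proof eventually_elim
          case (elim t)
          then have "inverse t \<le> dist x y"
            using False le_imp_inverse_le[of "inverse (dist x y)" t] by simp
          then show ?case by simp
        qed
        then show ?thesis by (rule tendsto_eventually)
      qed simp
    qed
    show "(\<lambda>y. indicator {y. inverse t \<le> dist x y} y *\<^sub>R ?k y) \<in> borel_measurable M" for t
      using integrable_mult_indicator[OF sets kernel_integrable[OF f]] by (rule borel_measurable_integrable)
  qed (use integrable_norm[OF kernel_integrable[OF f, of x]] kernel_integrable[OF f, of x] in auto)
  then have "((\<lambda>e. LINT y:{y. dist x y \<ge> e}|M. ?k y) \<longlongrightarrow> singular_integral \<delta> M f x) (at_right 0)"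
    unfolding filterlim_at_right_to_top singular_integral_def .
  moreover have "set_integrable M {y. dist x y \<ge> e} ?k" for e
    unfolding set_integrable_def by (rule integrable_mult_indicator[OF sets kernel_integrable[OF f]])
  ultimately show ?thesis
    by (simp add: has_pv_integral_def)
qed

section \<open>Identification of the logarithmic Dirichlet Laplacian\<close>

text \<open>
  The uniform kernel bound makes \<open>k(x,y) g(x)\<close> integrable on the product for every integrable \<open>g\<close>,
  and likewise \<open>k(x,y) g(y)\<close> by exchange of variables. By antisymmetry of \<open>k\<close> their integrals are
  opposite, so the difference is twice the first one; this absorbs the factor \<open>1/2\<close> in the form.
\<close>

lemma log_form_Din:
  fixes f g :: "'a \<Rightarrow> real"
  assumes f: "f \<in> Din" and g: "integrable M g"
  shows "log_form \<delta> M f g = L2_inner M (singular_integral \<delta> M f) g"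
proof -
  interpret MM: pair_sigma_finite M M ..
  define k where "k x y = (f x - f y) / dist x y powr \<delta>" for x y
  have kernel_antisym: "k y x = - k x y" for x y
    by (simp add: k_def dist_commute minus_divide_left)
  have swap: "(\<lambda>(x, y). case (y, x) of (x, y) \<Rightarrow> k x y * g x) = (\<lambda>(x, y). - (k x y * g y))"
    unfolding fun_eq_iff using kernel_antisym by (metis (no_types, lifting) case_prod_conv mult_minus_left surj_pair)
  have [measurable]: "(\<lambda>p. k (fst p) (snd p)) \<in> borel_measurable (M \<Otimes>\<^sub>M M)"
    using kernel_measurable[OF Din_measurable[OF f]] by (simp add: k_def case_prod_beta)
  have [measurable]: "g \<in> borel_measurable M" using g by simp
  obtain K where K: "K \<ge> 0"
    "\<And>x. (\<integral>\<^sup>+y. ennreal (\<bar>f x - f y\<bar> / dist x y powr \<delta>) \<partial>M) \<le> ennreal K"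
    using kernel_integral_bounded[OF f] by metis
  have int1: "integrable (M \<Otimes>\<^sub>M M) (\<lambda>(x, y). k x y * g x)"
  proof (rule integrableI_bounded)
    have [measurable]: "(\<lambda>y. k x y) \<in> borel_measurable M" for x
      using kernel_integrable[OF f, of x] by (simp add: k_def)
    have "(\<integral>\<^sup>+p. ennreal (norm (case p of (x, y) \<Rightarrow> k x y * g x)) \<partial>(M \<Otimes>\<^sub>M M))
        = (\<integral>\<^sup>+x. \<integral>\<^sup>+y. ennreal \<bar>k x y * g x\<bar> \<partial>M \<partial>M)"
      by (subst nn_integral_fst[symmetric]) (simp_all add: case_prod_beta)
    also have "\<dots> = (\<integral>\<^sup>+x. (\<integral>\<^sup>+y. ennreal \<bar>k x y\<bar> \<partial>M) * ennreal \<bar>g x\<bar> \<partial>M)"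
    proof (rule nn_integral_cong)
      fix x
      have [measurable]: "(\<lambda>y. ennreal \<bar>k x y\<bar>) \<in> borel_measurable M"
        by measurable
      show "(\<integral>\<^sup>+y. ennreal \<bar>k x y * g x\<bar> \<partial>M) = (\<integral>\<^sup>+y. ennreal \<bar>k x y\<bar> \<partial>M) * ennreal \<bar>g x\<bar>"
        unfolding abs_mult ennreal_mult''[OF abs_ge_zero] by (rule nn_integral_multc) fact
    qed
    also have "\<dots> \<le> (\<integral>\<^sup>+x. ennreal K * ennreal \<bar>g x\<bar> \<partial>M)"
      using K(2) by (intro nn_integral_mono mult_right_mono) (auto simp: k_def)
    also have "\<dots> = ennreal K * (\<integral>\<^sup>+x. ennreal \<bar>g x\<bar> \<partial>M)"
      by (simp add: nn_integral_cmult)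
    also have "\<dots> < \<infinity>"
      using g by (simp add: integrable_iff_bounded ennreal_mult_less_top)
    finally show "(\<integral>\<^sup>+p. ennreal (norm (case p of (x, y) \<Rightarrow> k x y * g x)) \<partial>(M \<Otimes>\<^sub>M M)) < \<infinity>" .
  qed (simp add: case_prod_beta)
  have int2: "integrable (M \<Otimes>\<^sub>M M) (\<lambda>(x, y). k x y * g y)"
    using MM.integrable_product_swap[OF int1] unfolding swap by (simp add: case_prod_unfold)
  have kernel_split: "(f x - f y) * (g x - g y) / dist x y powr \<delta> = k x y * g x - k x y * g y" for x y
  proof -
    have "(f x - f y) * (g x - g y) / dist x y powr \<delta> = k x y * (g x - g y)"
      by (simp add: k_def)
    then show ?thesis by (simp only: right_diff_distrib)
  qed
  have "(LINT x|M. LINT y|M. (f x - f y) * (g x - g y) / dist x y powr \<delta>)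
      = (LINT x|M. LINT y|M. (case (x, y) of (x, y) \<Rightarrow> k x y * g x) - (case (x, y) of (x, y) \<Rightarrow> k x y * g y))"
    by (simp add: kernel_split)
  also have "\<dots> = (LINT p|(M \<Otimes>\<^sub>M M). (case p of (x, y) \<Rightarrow> k x y * g x) - (case p of (x, y) \<Rightarrow> k x y * g y))"
    by (rule MM.integral_fst'[OF Bochner_Integration.integrable_diff[OF int1 int2]])
  also have "\<dots> = (LINT (x, y)|(M \<Otimes>\<^sub>M M). k x y * g x) - (LINT (x, y)|(M \<Otimes>\<^sub>M M). k x y * g y)"
    by (rule Bochner_Integration.integral_diff[OF int1 int2])
  also have "(LINT (x, y)|(M \<Otimes>\<^sub>M M). k x y * g y) = - (LINT (x, y)|(M \<Otimes>\<^sub>M M). k x y * g x)"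
    using MM.integral_product_swap[OF borel_measurable_integrable[OF int1]]
    unfolding swap by (simp add: case_prod_unfold)
  also have "(LINT (x, y)|(M \<Otimes>\<^sub>M M). k x y * g x) = (LINT x|M. LINT y|M. k x y * g x)"
    using MM.integral_fst'[OF int1] by simp
  also have "\<dots> = L2_inner M (singular_integral \<delta> M f) g"
  proof -
    have "singular_integral \<delta> M f x = (LINT y|M. k x y)" for x
      by (simp only: singular_integral_def k_def)
    then show ?thesis by (simp add: L2_inner_def)
  qed
  finally show ?thesis
    unfolding log_form_eq by simp
qed

lemma Din_represents_resolvent:
  fixes f :: "'a \<Rightarrow> real"
  assumes f: "f \<in> Din"
  shows "represents_resolvent \<delta> M (\<lambda>x. f x + singular_integral \<delta> M f x) f"
  unfolding represents_resolvent_def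
proof (intro conjI ballI)
  show dom: "f \<in> Dom_form \<delta> M" using f Din_subset_Dom_form by blast
  fix g assume "g \<in> Dom_form \<delta> M"
  then have g: "g \<in> L2 M" and f2: "f \<in> L2 M" using dom by (auto simp: Dom_form_def)
  show "L2_inner M f g + log_form \<delta> M f g
      = L2_inner M (\<lambda>x. f x + singular_integral \<delta> M f x) g"
    unfolding log_form_Din[OF f L2_integrable[OF g]]
    using L2_integrable_mult[OF f2 g] L2_integrable_mult[OF singular_integral_L2[OF f] g]
    by (simp add: L2_inner_def distrib_right)
qed

text \<open>
  Two right-hand sides with the same resolvent have the same inner products with the form domain,
  in particular with all bounded Lipschitz functions.
\<close>

lemma represents_resolvent_inj:
  assumes "represents_resolvent \<delta> M f u" "represents_resolvent \<delta> M f' u"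
    and "f \<in> L2 M" "f' \<in> L2 M"
  shows "AE x in M. f x = f' x"
proof -
  have "AE x in M. f x - f' x = 0"
  proof (rule AE_zero_if_orthogonal_to_lipschitz)
    show "integrable M (\<lambda>x. f x - f' x)"
      using assms(3,4) by (intro Bochner_Integration.integrable_diff L2_integrable)
    fix g :: "'a \<Rightarrow> real" and L assume "bounded (range g)" "L-lipschitz_on UNIV g"
    then have g: "g \<in> Dom_form \<delta> M"
      using lipschitz_in_Din[OF diameter] Din_subset_Dom_form by blast
    then have "L2_inner M f g = L2_inner M f' g"
      using assms(1,2) by (simp add: represents_resolvent_def)
    moreover have "g \<in> L2 M" using g by (simp add: Dom_form_def)
    ultimately show "(LINT x|M. (f x - f' x) * g x) = 0"
      using L2_integrable_mult[of f g] L2_integrable_mult[of f' g] assms(3,4)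
      by (simp add: L2_inner_def left_diff_distrib)
  qed
  then show ?thesis by simp
qed

text \<open>
  The singular integral is an admissible choice for the Laplacian, and by injectivity of the
  resolvent any two admissible choices agree almost everywhere.
\<close>

lemma log_laplacian_Din:
  fixes f :: "'a \<Rightarrow> real"
  assumes f: "f \<in> Din"
  shows "log_laplacian \<delta> M f \<in> L2 M"
    and "AE x in M. log_laplacian \<delta> M f x = singular_integral \<delta> M f x"
proof -
  let ?h = "singular_integral \<delta> M f"
  let ?P = "\<lambda>v. v \<in> L2 M \<and> (\<exists>F\<in>L2 M. represents_resolvent \<delta> M F f \<and> (AE x in M. v x = F x - f x))"
  have F: "(\<lambda>x. f x + ?h x) \<in> L2 M"
    using f Din_subset_Dom_form singular_integral_L2[OF f] by (intro L2_add) (auto simp: Dom_form_def)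
  have "?P ?h"
    using singular_integral_L2[OF f] F Din_represents_resolvent[OF f]
    by (auto intro!: bexI[of _ "\<lambda>x. f x + ?h x"])
  then have P: "?P (log_laplacian \<delta> M f)"
    unfolding log_laplacian_def by (rule someI[of ?P])
  then show "log_laplacian \<delta> M f \<in> L2 M" by simp
  obtain F' where F': "F' \<in> L2 M" "represents_resolvent \<delta> M F' f"
    "AE x in M. log_laplacian \<delta> M f x = F' x - f x"
    using P by auto
  show "AE x in M. log_laplacian \<delta> M f x = ?h x"
    using represents_resolvent_inj[OF F'(2) Din_represents_resolvent[OF f] F'(1) F] F'(3)
    by eventually_elim simp
qed

end

theorem proposition4p11:
  fixes M :: "'a::{metric_space, second_countable_topology} measure" and \<delta> :: real
  assumes "\<delta> > 0"
    and "metric_measure_space M"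
    and "ahlfors_regular \<delta> M"
  shows "Din \<subseteq> Dom_log_laplacian \<delta> M \<and>
    Linf M \<subseteq> L2 M \<and>
    (\<forall>f\<in>Din.
       (\<exists>h\<in>L2 M.
          (\<forall>x. has_pv_integral M x (\<lambda>y. (f x - f y) / dist x y powr \<delta>) (h x)) \<and>
          (AE x in M. log_laplacian \<delta> M f x = h x)) \<and>
       log_laplacian \<delta> M f \<in> Linf M)"
proof -
  have M: "finite_measure M" "sets M = sets borel"
    using assms(2) by (auto simp: metric_measure_space_def)
  obtain D where D: "D \<ge> 0" "ediam TYPE('a) = ereal D"
    using ediam_finite[OF assms(1) M(1) assms(3)] .
  obtain C where "\<And>(x::'a) r. 0 \<le> r \<Longrightarrow> r < D \<Longrightarrow> measure M (cball x r) \<le> C * r powr \<delta>"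
    using assms(3) D by (auto simp: ahlfors_regular_def)
  then interpret upper_regular_space M \<delta> D C
    using assms(1) M D by (intro upper_regular_space.intro finite_borel_measure.intro
      finite_borel_measure_axioms.intro upper_regular_space_axioms.intro)
  have "f \<in> Dom_log_laplacian \<delta> M" if f: "f \<in> Din" for f
  proof -
    have "(\<lambda>x. f x + singular_integral \<delta> M f x) \<in> L2 M"
      using f Din_subset_Dom_form singular_integral_L2[OF f] by (intro L2_add) (auto simp: Dom_form_def)
    then show ?thesis
      using Din_represents_resolvent[OF f] by (auto simp: Dom_log_laplacian_def)
  qed
  moreover have "log_laplacian \<delta> M f \<in> Linf M" if f: "f \<in> Din" for f
  proof -
    obtain B where "AE x in M. \<bar>singular_integral \<delta> M f x\<bar> \<le> B"
      using singular_integral_Linf[OF f] by (auto simp: Linf_def)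
    then have "AE x in M. \<bar>log_laplacian \<delta> M f x\<bar> \<le> B"
      using log_laplacian_Din(2)[OF f] by eventually_elim simp
    then show ?thesis
      using log_laplacian_Din(1)[OF f] by (auto simp: Linf_def L2_def)
  qed
  ultimately show ?thesis
    using Linf_subset_L2 singular_integral_L2 has_pv_singular_integral log_laplacian_Din(2) by blast
qed

end
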